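(* Let $\mathsf{A}=(A_1,\dots,A_N)\in GL_2(\mathbb{R})^N$ be dominated and reducible, with $\|A_i\|<1$ for all $i$, such that $X_F$ is not a singleton. Then, after possibly a change of basis, $$A_i=\begin{pmatrix}a_i&b_i\\0&d_i\end{pmatrix}\quad\text{with }0<|d_i|<|a_i|<1\text{ for all }i\in\{1,\dots,N\},$$ and the matrices $A_1,\dots,A_N$ are not simultaneously diagonalizable.
   Context: For a finite word $\mathtt{i}=i_1\cdots i_n$, $A_{\mathtt{i}}=A_{i_1}\cdots A_{i_n}$, $|\mathtt{i}|=n$; $\Sigma_*$ is the set of finite words. Dominated: $\exists C>0,0<\tau<1$ with $\alpha_2(A_{\mathtt{i}})\le C\tau^{|\mathtt{i}|}\alpha_1(A_{\mathtt{i}})$ for all $\mathtt{i}\in\Sigma_*$, where $\alpha_1\ge\alpha_2$ are singular values. Reducible: some line through the origin is invariant under all $A_i$. Furstenberg directions: $X_F=\{A\mathbb{R}^2: A$ rank-one matrix in the closure of $\{cA_{i_1}^{-1}\cdots A_{i_n}^{-1}: c\in\mathbb{R}, i_1\cdots i_n\in\Sigma_*\}\}$. *)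

theory Defs
  imports "HOL-Analysis.Analysis"
begin

type_synonym mat2 = "real^2^2"

text \<open>Product A_w = A_{i1} ... A_{in} for a finite word w = [i1,...,in].\<close>
definition word_prod :: "(nat \<Rightarrow> mat2) \<Rightarrow> nat list \<Rightarrow> mat2" where
  "word_prod A w = foldr (\<lambda>i M. A i ** M) w (mat 1)"

text \<open>Product A_{i1}^{-1} ... A_{in}^{-1}.\<close>
definition word_inv_prod :: "(nat \<Rightarrow> mat2) \<Rightarrow> nat list \<Rightarrow> mat2" where
  "word_inv_prod A w = foldr (\<lambda>i M. matrix_inv (A i) ** M) w (mat 1)"

text \<open>Finite words over the alphabet {0,...,N-1}.\<close>
definition words :: "nat \<Rightarrow> nat list set" where
  "words N = lists {..<N}"

text \<open>Singular values: square roots of the eigenvalues of A^T A (largest and smallest).\<close>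
definition eig_AtA :: "mat2 \<Rightarrow> real set" where
  "eig_AtA M = {l. \<exists>v. v \<noteq> 0 \<and> (transpose M ** M) *v v = l *\<^sub>R v}"

definition sv1 :: "mat2 \<Rightarrow> real" where
  "sv1 M = sqrt (Max (eig_AtA M))"

definition sv2 :: "mat2 \<Rightarrow> real" where
  "sv2 M = sqrt (Min (eig_AtA M))"

definition dominated :: "nat \<Rightarrow> (nat \<Rightarrow> mat2) \<Rightarrow> bool" where
  "dominated N A \<longleftrightarrow> (\<exists>C>0. \<exists>\<tau>. 0 < \<tau> \<and> \<tau> < 1 \<and>
     (\<forall>w \<in> words N. sv2 (word_prod A w) \<le> C * \<tau> ^ length w * sv1 (word_prod A w)))"

definition reducible :: "nat \<Rightarrow> (nat \<Rightarrow> mat2) \<Rightarrow> bool" where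
  "reducible N A \<longleftrightarrow> (\<exists>v::real^2. v \<noteq> 0 \<and> (\<forall>i<N. \<exists>c::real. A i *v v = c *\<^sub>R v))"

text \<open>Furstenberg directions: images of rank-one matrices in the closure of
  {c A_{i1}^{-1}...A_{in}^{-1}}.\<close>
definition furstenberg_dirs :: "nat \<Rightarrow> (nat \<Rightarrow> mat2) \<Rightarrow> (real^2) set set" where
  "furstenberg_dirs N A =
     {range ((*v) B) | B. rank B = 1 \<and>
        B \<in> closure {c *\<^sub>R word_inv_prod A w | c w. w \<in> words N}}"

definition diagonal_mat :: "mat2 \<Rightarrow> bool" where
  "diagonal_mat M \<longleftrightarrow> (\<forall>j k. j \<noteq> k \<longrightarrow> M $ j $ k = 0)"

text \<open>Operator norm of a matrix (w.r.t. the Euclidean norm).\<close>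
definition opnorm :: "mat2 \<Rightarrow> real" where
  "opnorm M = onorm ((*v) M)"

end

theory Submission
  imports Defs "HOL-Library.Quadratic_Discriminant" "HOL-Real_Asymp.Real_Asymp"
begin

(*
  Conjugating by a basis whose first vector spans the common invariant line makes every A_i
  upper triangular, with diagonal entries a_i, d_i and |a_i| <= ||A_i|| < 1.

  Domination survives this change of basis in the weaker form
  |det A_w| <= C tau^|w| ||A_w||_F^2.  For a triangular product W with diagonal entries
  alpha, delta one has det W^k = (alpha delta)^k, while ||W^k||_F^2 grows at most like
  k^2 max(|alpha|, |delta|)^(2k); hence along every word one diagonal product beats the other
  by the factor tau^|w|.  A word built greedily from a letter with |d_i| < |a_i| and one with
  |a_i| < |d_i| would keep the two products comparable, so the same inequality holds for all i.

  If it were |a_i| < |d_i|, all normalised products of the inverses, and their limits, would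
  be triangular with dominant (1,1) entry.  Every rank-one limit then has the invariant line as
  image, and one exists (normalised powers of A_1^-1), so X_F would be a singleton.  A
  simultaneous diagonalisation is excluded because swapping its basis vectors would give a
  triangular form with the forbidden ordering.
*)

section \<open>Similarity\<close>

lemma matrix_inv_right:
  fixes A :: "'a::field^'n^'n"
  assumes "invertible A"
  shows "A ** matrix_inv A = mat 1"
  using someI_ex[OF assms[unfolded invertible_def]] unfolding matrix_inv_def by blast

lemma matrix_inv_left:
  fixes A :: "'a::field^'n^'n"
  assumes "invertible A"
  shows "matrix_inv A ** A = mat 1"
  using someI_ex[OF assms[unfolded invertible_def]] unfolding matrix_inv_def by blast

lemma matrix_inv_unique:
  fixes A B :: "'a::field^'n^'n"
  assumes "invertible A" and "B ** A = mat 1"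
  shows "matrix_inv A = B"
  by (metis assms matrix_inv_right matrix_mul_assoc matrix_mul_lid matrix_mul_rid)

lemma invertible_matrix_inv:
  fixes A :: "'a::field^'n^'n"
  assumes "invertible A"
  shows "invertible (matrix_inv A)"
  using assms invertible_left_inverse matrix_inv_right by blast

lemma invertible_similar:
  fixes A R :: "'a::field^'n^'n"
  assumes "invertible R" and "invertible A"
  shows "invertible (matrix_inv R ** A ** R)"
  by (intro invertible_mult invertible_matrix_inv assms)

lemma similar_inverse_cancel:
  fixes A R :: "'a::field^'n^'n"
  assumes "invertible R"
  shows "R ** (matrix_inv R ** A ** R) ** matrix_inv R = A"
  by (simp add: assms matrix_mul_assoc matrix_inv_right)
     (simp add: assms matrix_mul_assoc[symmetric] matrix_inv_right)

lemma similar_mult: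
  fixes A B R :: "'a::field^'n^'n"
  assumes "invertible R"
  shows "(matrix_inv R ** A ** R) ** (matrix_inv R ** B ** R) = matrix_inv R ** (A ** B) ** R"
  by (metis assms matrix_inv_right matrix_mul_assoc matrix_mul_rid)

lemma matrix_inv_similar:
  fixes A R :: "'a::field^'n^'n"
  assumes "invertible R" and "invertible A"
  shows "matrix_inv (matrix_inv R ** A ** R) = matrix_inv R ** matrix_inv A ** R"
  by (intro matrix_inv_unique invertible_similar assms)
     (simp add: similar_mult assms matrix_inv_left matrix_inv_right)

lemma det_similar:
  fixes A R :: "real^'n^'n"
  assumes "invertible R"
  shows "det (matrix_inv R ** A ** R) = det A"
proof -
  have "det (matrix_inv R) * det R = 1"
    by (metis assms det_I det_mul matrix_inv_left)
  then show ?thesis by (simp add: det_mul)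
qed

lemma linear_matrix_sandwich: "linear (\<lambda>B::real^'n^'m. P ** B ** Q)"
  by (rule linearI) (vector matrix_matrix_mult_def sum.distrib[symmetric] sum_distrib_left
      field_simps scaleR_sum_right)+

section \<open>Two-by-two matrices\<close>

lemma matrix_mult_nth_2:
  "((A::'a::semiring_1^2^2) ** B)$i$j = A$i$1 * B$1$j + A$i$2 * B$2$j"
  by (simp add: matrix_matrix_mult_def sum_2)

lemma matrix_vector_mult_nth_2: "((A::'a::semiring_1^2^2) *v x)$i = A$i$1 * x$1 + A$i$2 * x$2"
  by (simp add: matrix_vector_mult_def sum_2)

lemma vec2_eq_iff: "(x::'a^2) = y \<longleftrightarrow> x$1 = y$1 \<and> x$2 = y$2"
  by (auto simp: vec_eq_iff forall_2)

lemma mat2_eq_iff: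
  "(A::'a^2^2) = B \<longleftrightarrow> A$1$1 = B$1$1 \<and> A$1$2 = B$1$2 \<and> A$2$1 = B$2$1 \<and> A$2$2 = B$2$2"
  by (auto simp: vec2_eq_iff)

lemma mat_1_nth_2 [simp]:
  "(mat 1 :: 'a::zero_neq_one^2^2)$1$1 = 1" "(mat 1 :: 'a^2^2)$1$2 = 0"
  "(mat 1 :: 'a^2^2)$2$1 = 0" "(mat 1 :: 'a^2^2)$2$2 = 1"
  by (simp_all add: mat_def)

definition mat2x2 :: "'a \<Rightarrow> 'a \<Rightarrow> 'a \<Rightarrow> 'a \<Rightarrow> 'a^2^2" where
  "mat2x2 a b c d = (\<chi> i j. if i = 1 then (if j = 1 then a else b) else (if j = 1 then c else d))"

lemma mat2x2_nth [simp]: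
  "mat2x2 a b c d $1$1 = a" "mat2x2 a b c d $1$2 = b"
  "mat2x2 a b c d $2$1 = c" "mat2x2 a b c d $2$2 = d"
  by (simp_all add: mat2x2_def)

lemma det_upper_triangular_2: "(A::real^2^2)$2$1 = 0 \<Longrightarrow> det A = A$1$1 * A$2$2"
  by (simp add: det_2)

lemma invertible_upper_triangular_2:
  assumes "invertible (A::real^2^2)" and "A$2$1 = 0"
  shows "A$1$1 \<noteq> 0" and "A$2$2 \<noteq> 0"
  using assms invertible_det_nz det_upper_triangular_2 by force+

lemma matrix_inv_upper_triangular_2:
  assumes "invertible (A::real^2^2)" and "A$2$1 = 0"
  shows "matrix_inv A = mat2x2 (1 / A$1$1) (- A$1$2 / (A$1$1 * A$2$2)) 0 (1 / A$2$2)"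
  using invertible_upper_triangular_2[OF assms]
  by (intro matrix_inv_unique assms(1)) (simp add: mat2_eq_iff matrix_mult_nth_2 assms(2) field_simps)

lemma rank_eq_1_2: "rank (B::real^2^2) = 1 \<longleftrightarrow> B \<noteq> 0 \<and> det B = 0"
  using rank_eq_0[of B] det_eq_0_rank[of B] by auto

lemma similar_swap_2:
  fixes Q :: "real^2^2"
  assumes "invertible Q"
  obtains Q' where "invertible Q'" and
    "\<And>M. matrix_inv Q' ** M ** Q' =
      mat2x2 ((matrix_inv Q ** M ** Q)$2$2) ((matrix_inv Q ** M ** Q)$2$1)
             ((matrix_inv Q ** M ** Q)$1$2) ((matrix_inv Q ** M ** Q)$1$1)"
proof
  define S :: "real^2^2" where "S = mat2x2 0 1 1 0"
  have SS: "S ** S = mat 1" by (simp add: S_def mat2_eq_iff matrix_mult_nth_2)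
  have S: "invertible S" using SS invertible_left_inverse by blast
  then show QS: "invertible (Q ** S)" by (intro invertible_mult assms)
  have "matrix_inv (Q ** S) = S ** matrix_inv Q"
    by (intro matrix_inv_unique QS)
       (metis SS assms matrix_inv_left matrix_mul_assoc matrix_mul_rid)
  then show "matrix_inv (Q ** S) ** M ** (Q ** S) = mat2x2 ((matrix_inv Q ** M ** Q)$2$2)
    ((matrix_inv Q ** M ** Q)$2$1) ((matrix_inv Q ** M ** Q)$1$2) ((matrix_inv Q ** M ** Q)$1$1)" for M
    by (simp add: matrix_mul_assoc mat2_eq_iff) (simp add: matrix_mult_nth_2 S_def)
qed

section \<open>Products along words\<close>

lemma word_prod_Nil [simp]: "word_prod A [] = mat 1"
  and word_prod_Cons [simp]: "word_prod A (i # w) = A i ** word_prod A w"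
  by (simp_all add: word_prod_def)

lemma word_inv_prod_eq_word_prod: "word_inv_prod A w = word_prod (\<lambda>i. matrix_inv (A i)) w"
  by (simp add: word_inv_prod_def word_prod_def)

lemma word_prod_append: "word_prod A (u @ v) = word_prod A u ** word_prod A v"
  by (induction u) (simp_all add: matrix_mul_assoc)

lemma words_concat_replicate: "w \<in> words N \<Longrightarrow> concat (replicate k w) \<in> words N"
  by (auto simp: words_def)

primrec matrix_pow :: "'a::semiring_1^'n^'n \<Rightarrow> nat \<Rightarrow> 'a^'n^'n" where
  "matrix_pow W 0 = mat 1"
| "matrix_pow W (Suc k) = W ** matrix_pow W k"

lemma word_prod_concat_replicate: "word_prod A (concat (replicate k w)) = matrix_pow (word_prod A w) k"
  by (induction k) (simp_all add: word_prod_append)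

lemma word_prod_replicate: "word_prod A (replicate k i) = matrix_pow (A i) k"
  by (induction k) simp_all

lemma word_prod_similar:
  assumes "invertible R"
  shows "word_prod (\<lambda>i. matrix_inv R ** A i ** R) w = matrix_inv R ** word_prod A w ** R"
  by (induction w) (simp_all add: assms matrix_inv_left similar_mult)

lemma word_inv_prod_similar:
  assumes "invertible R" and "\<forall>i\<in>set w. invertible (A i)"
  shows "word_inv_prod (\<lambda>i. matrix_inv R ** A i ** R) w = matrix_inv R ** word_inv_prod A w ** R"
  using assms(2) unfolding word_inv_prod_eq_word_prod
  by (induction w) (simp_all add: assms(1) matrix_inv_left matrix_inv_similar similar_mult)

lemma word_prod_upper_triangular:
  assumes "\<forall>i\<in>set w. (T i :: real^2^2)$2$1 = 0"
  shows "(word_prod T w)$2$1 = 0"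
    and "(word_prod T w)$1$1 = prod_list (map (\<lambda>i. T i$1$1) w)"
    and "(word_prod T w)$2$2 = prod_list (map (\<lambda>i. T i$2$2) w)"
  using assms by (induction w) (auto simp: matrix_mult_nth_2)

lemma matrix_pow_upper_triangular:
  fixes W :: "real^2^2"
  assumes "W$2$1 = 0"
  shows "(matrix_pow W k)$2$1 = 0" and "(matrix_pow W k)$1$1 = (W$1$1)^k"
    and "(matrix_pow W k)$2$2 = (W$2$2)^k"
    and "(W$1$1 - W$2$2) * (matrix_pow W k)$1$2 = W$1$2 * ((W$1$1)^k - (W$2$2)^k)"
proof -
  have diag: "(matrix_pow W n)$2$1 = 0 \<and> (matrix_pow W n)$1$1 = (W$1$1)^n \<and>
    (matrix_pow W n)$2$2 = (W$2$2)^n" for n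
    by (induction n) (simp_all add: assms matrix_mult_nth_2)
  then show "(matrix_pow W k)$2$1 = 0" "(matrix_pow W k)$1$1 = (W$1$1)^k"
    "(matrix_pow W k)$2$2 = (W$2$2)^k"
    by simp_all
  show "(W$1$1 - W$2$2) * (matrix_pow W k)$1$2 = W$1$2 * ((W$1$1)^k - (W$2$2)^k)"
  proof (induction k)
    case (Suc k)
    have "(W$1$1 - W$2$2) * (matrix_pow W (Suc k))$1$2
        = W$1$1 * ((W$1$1 - W$2$2) * (matrix_pow W k)$1$2) + (W$1$1 - W$2$2) * W$1$2 * (W$2$2)^k"
      by (simp add: matrix_mult_nth_2 diag algebra_simps)
    also have "\<dots> = W$1$2 * ((W$1$1)^Suc k - (W$2$2)^Suc k)"
      unfolding Suc.IH by (simp add: algebra_simps)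
    finally show ?case .
  qed simp
qed

section \<open>Singular values and domination\<close>

definition frob_sq :: "real^2^2 \<Rightarrow> real" where
  "frob_sq M = (M$1$1)^2 + (M$1$2)^2 + (M$2$1)^2 + (M$2$2)^2"

lemma frob_sq_nonneg: "0 \<le> frob_sq M"
  by (simp add: frob_sq_def)

lemma frob_sq_mult: "frob_sq (X ** Y) \<le> frob_sq X * frob_sq Y"
proof -
  have cauchy_schwarz: "(a * b + c * d)^2 \<le> (a^2 + c^2) * (b^2 + d^2)" for a b c d :: real
  proof -
    have "0 \<le> (a * d - c * b)^2" by simp
    then show ?thesis by (simp add: power2_eq_square algebra_simps)
  qed
  have "frob_sq (X ** Y) \<le> (X$1$1^2 + X$1$2^2) * (Y$1$1^2 + Y$2$1^2) + (X$1$1^2 + X$1$2^2) * (Y$1$2^2 + Y$2$2^2)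
     + (X$2$1^2 + X$2$2^2) * (Y$1$1^2 + Y$2$1^2) + (X$2$1^2 + X$2$2^2) * (Y$1$2^2 + Y$2$2^2)"
    unfolding frob_sq_def matrix_mult_nth_2 by (intro add_mono cauchy_schwarz)
  also have "\<dots> = frob_sq X * frob_sq Y"
    by (simp add: frob_sq_def algebra_simps)
  finally show ?thesis .
qed

lemma frob_sq_sandwich: "frob_sq (P ** X ** Q) \<le> frob_sq P * frob_sq Q * frob_sq X"
proof -
  have "frob_sq (P ** X ** Q) \<le> frob_sq (P ** X) * frob_sq Q"
    by (rule frob_sq_mult)
  also have "\<dots> \<le> frob_sq P * frob_sq X * frob_sq Q"
    by (intro mult_right_mono frob_sq_mult frob_sq_nonneg)
  finally show ?thesis by (simp add: mult_ac)
qed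

lemma eig_AtA_iff: "l \<in> eig_AtA M \<longleftrightarrow> l^2 - frob_sq M * l + (det M)^2 = 0"
proof -
  define S where "S = transpose M ** M - mat l"
  have det_S: "det S = l^2 - frob_sq M * l + (det M)^2"
    by (simp add: S_def det_2 mat_def frob_sq_def matrix_mult_nth_2 transpose_def
        power2_eq_square algebra_simps)
  have "S *v v = 0 \<longleftrightarrow> (transpose M ** M) *v v = l *\<^sub>R v" for v
    by (simp add: S_def vec2_eq_iff matrix_vector_mult_nth_2 mat_def algebra_simps)
  then have "l \<in> eig_AtA M \<longleftrightarrow> (\<exists>v. v \<noteq> 0 \<and> S *v v = 0)"
    by (simp add: eig_AtA_def)
  also have "\<dots> \<longleftrightarrow> det S = 0"
    using rank_bound[of S] by (auto simp: matrix_nonfull_linear_equations_eq det_eq_0_rank)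
  finally show ?thesis
    using det_S by simp
qed

lemma eig_AtA_eq:
  fixes M :: "real^2^2"
  defines "\<Delta> \<equiv> (frob_sq M)^2 - 4 * (det M)^2"
  shows "0 \<le> \<Delta>"
    and "eig_AtA M = {(frob_sq M + sqrt \<Delta>) / 2, (frob_sq M - sqrt \<Delta>) / 2}"
proof -
  have "\<Delta> = ((M$1$1)^2 + (M$2$1)^2 - (M$1$2)^2 - (M$2$2)^2)^2
      + 4 * (M$1$1 * M$1$2 + M$2$1 * M$2$2)^2"
    by (simp add: \<Delta>_def frob_sq_def det_2 power2_eq_square algebra_simps)
  then show \<Delta>: "0 \<le> \<Delta>" by simp
  have "discrim 1 (- frob_sq M) ((det M)^2) = \<Delta>"
    by (simp add: discrim_def \<Delta>_def)
  with \<Delta> have "l \<in> eig_AtA M \<longleftrightarrow> l = (frob_sq M + sqrt \<Delta>) / 2 \<or> l = (frob_sq M - sqrt \<Delta>) / 2" for l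
    using discriminant_nonneg[of 1 "- frob_sq M" "(det M)^2" l] by (simp add: eig_AtA_iff)
  then show "eig_AtA M = {(frob_sq M + sqrt \<Delta>) / 2, (frob_sq M - sqrt \<Delta>) / 2}"
    by blast
qed

lemma sv1_nonneg: "0 \<le> sv1 M"
  and sv1_sq_le_frob_sq: "(sv1 M)^2 \<le> frob_sq M"
  and sv1_mult_sv2: "sv1 M * sv2 M = \<bar>det M\<bar>"
proof -
  define t where "t = frob_sq M"
  define \<Delta> where "\<Delta> = t^2 - 4 * (det M)^2"
  have \<Delta>: "0 \<le> \<Delta>" and eig: "eig_AtA M = {(t + sqrt \<Delta>) / 2, (t - sqrt \<Delta>) / 2}"
    using eig_AtA_eq[of M] unfolding \<Delta>_def t_def by simp_all
  have "sqrt \<Delta> \<le> sqrt (t^2)"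
    unfolding \<Delta>_def by (intro real_sqrt_le_mono) simp
  then have root: "sqrt \<Delta> \<le> t"
    using frob_sq_nonneg[of M] by (simp add: t_def)
  have sv1: "sv1 M = sqrt ((t + sqrt \<Delta>) / 2)" and sv2: "sv2 M = sqrt ((t - sqrt \<Delta>) / 2)"
    unfolding sv1_def sv2_def eig using \<Delta> by simp_all
  have "0 \<le> (t + sqrt \<Delta>) / 2"
    using root real_sqrt_ge_zero[OF \<Delta>] by argo
  then show "0 \<le> sv1 M" and "(sv1 M)^2 \<le> frob_sq M"
    using root by (simp_all add: sv1 t_def[symmetric])
  have "(t + sqrt \<Delta>) / 2 * ((t - sqrt \<Delta>) / 2) = (det M)^2"
    using \<Delta> by (simp add: \<Delta>_def field_simps power2_eq_square)
  then show "sv1 M * sv2 M = \<bar>det M\<bar>"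
    by (simp add: sv1 sv2 real_sqrt_mult[symmetric])
qed

lemma abs_det_le_frob_sq:
  assumes "sv2 M \<le> K * sv1 M" and "0 \<le> K"
  shows "\<bar>det M\<bar> \<le> K * frob_sq M"
proof -
  have "\<bar>det M\<bar> = sv1 M * sv2 M"
    by (simp add: sv1_mult_sv2)
  also have "\<dots> \<le> sv1 M * (K * sv1 M)"
    using assms(1) by (intro mult_left_mono sv1_nonneg)
  also have "\<dots> \<le> K * frob_sq M"
    using sv1_sq_le_frob_sq[of M] assms(2) by (simp add: power2_eq_square mult_left_mono mult.left_commute)
  finally show ?thesis .
qed

text \<open>Unlike the condition on singular values, this form of domination is invariant under a
  change of basis (with a different constant).\<close>

definition det_dominated :: "nat \<Rightarrow> (nat \<Rightarrow> real^2^2) \<Rightarrow> bool" where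
  "det_dominated N A \<longleftrightarrow> (\<exists>C>0. \<exists>\<tau>. 0 < \<tau> \<and> \<tau> < 1 \<and>
     (\<forall>w \<in> words N. \<bar>det (word_prod A w)\<bar> \<le> C * \<tau> ^ length w * frob_sq (word_prod A w)))"

lemma dominated_imp_det_dominated: "dominated N A \<Longrightarrow> det_dominated N A"
  unfolding dominated_def det_dominated_def by (meson abs_det_le_frob_sq less_le zero_le_power mult_nonneg_nonneg)

lemma det_dominated_similar:
  assumes "invertible R" and "det_dominated N A"
  shows "det_dominated N (\<lambda>i. matrix_inv R ** A i ** R)"
proof -
  obtain C \<tau> where C: "C > 0" and \<tau>: "0 < \<tau>" "\<tau> < 1"
    and dom: "\<forall>w \<in> words N. \<bar>det (word_prod A w)\<bar> \<le> C * \<tau> ^ length w * frob_sq (word_prod A w)"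
    using assms(2) unfolding det_dominated_def by blast
  define K where "K = frob_sq R * frob_sq (matrix_inv R) + 1"
  have K: "K > 0" unfolding K_def by (simp add: add_nonneg_pos frob_sq_nonneg)
  have "\<bar>det (word_prod (\<lambda>i. matrix_inv R ** A i ** R) w)\<bar>
      \<le> C * K * \<tau> ^ length w * frob_sq (word_prod (\<lambda>i. matrix_inv R ** A i ** R) w)"
    if "w \<in> words N" for w
  proof -
    define W where "W = word_prod (\<lambda>i. matrix_inv R ** A i ** R) w"
    have A_w: "word_prod A w = R ** W ** matrix_inv R"
      by (simp add: W_def word_prod_similar assms(1) similar_inverse_cancel)
    have "\<bar>det W\<bar> = \<bar>det (word_prod A w)\<bar>"
      by (simp add: W_def word_prod_similar det_similar assms(1))
    also have "\<dots> \<le> C * \<tau> ^ length w * frob_sq (R ** W ** matrix_inv R)"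
      unfolding A_w[symmetric] using dom that by blast
    also have "\<dots> \<le> C * \<tau> ^ length w * (K * frob_sq W)"
      using C \<tau> frob_sq_sandwich[of R W "matrix_inv R"] frob_sq_nonneg[of W]
      by (intro mult_left_mono) (simp_all add: K_def distrib_right)
    finally show ?thesis by (simp add: W_def mult_ac)
  qed
  then show ?thesis
    unfolding det_dominated_def using C K \<tau> by (intro exI[of _ "C * K"]) auto
qed

section \<open>Separation of the diagonal\<close>

lemma matrix_pow_upper_triangular_bound:
  fixes W :: "real^2^2"
  assumes "W$2$1 = 0"
  defines "\<rho> \<equiv> max \<bar>W$1$1\<bar> \<bar>W$2$2\<bar>"
  shows "\<rho> * \<bar>(matrix_pow W k)$1$2\<bar> \<le> real k * \<bar>W$1$2\<bar> * \<rho>^k"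
proof (induction k)
  case (Suc k)
  have \<rho>: "0 \<le> \<rho>" "\<bar>W$1$1\<bar> \<le> \<rho>" "\<bar>W$2$2\<bar> \<le> \<rho>"
    by (auto simp: \<rho>_def)
  have "\<bar>(matrix_pow W (Suc k))$1$2\<bar> \<le> \<bar>W$1$1\<bar> * \<bar>(matrix_pow W k)$1$2\<bar> + \<bar>W$1$2\<bar> * \<bar>W$2$2\<bar>^k"
    using abs_triangle_ineq[of "W$1$1 * (matrix_pow W k)$1$2" "W$1$2 * (W$2$2)^k"]
    by (simp add: matrix_mult_nth_2 matrix_pow_upper_triangular assms(1) abs_mult power_abs)
  then have "\<rho> * \<bar>(matrix_pow W (Suc k))$1$2\<bar>
      \<le> \<bar>W$1$1\<bar> * (\<rho> * \<bar>(matrix_pow W k)$1$2\<bar>) + \<rho> * (\<bar>W$1$2\<bar> * \<bar>W$2$2\<bar>^k)"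
    using mult_left_mono[OF _ \<rho>(1)] by (fastforce simp: algebra_simps)
  also have "\<dots> \<le> \<rho> * (real k * \<bar>W$1$2\<bar> * \<rho>^k) + \<rho> * (\<bar>W$1$2\<bar> * \<rho>^k)"
  proof (rule add_mono)
    show "\<bar>W$1$1\<bar> * (\<rho> * \<bar>(matrix_pow W k)$1$2\<bar>) \<le> \<rho> * (real k * \<bar>W$1$2\<bar> * \<rho>^k)"
      by (rule mult_mono) (use \<rho> Suc.IH in auto)
    show "\<rho> * (\<bar>W$1$2\<bar> * \<bar>W$2$2\<bar>^k) \<le> \<rho> * (\<bar>W$1$2\<bar> * \<rho>^k)"
      using \<rho> by (intro mult_left_mono power_mono) auto
  qed
  also have "\<dots> = real (Suc k) * \<bar>W$1$2\<bar> * \<rho>^Suc k"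
    by (simp add: algebra_simps)
  finally show ?case .
qed simp

lemma frob_sq_matrix_pow_upper_triangular:
  fixes W :: "real^2^2"
  assumes "W$2$1 = 0" and "1 \<le> k"
  defines "\<rho> \<equiv> max \<bar>W$1$1\<bar> \<bar>W$2$2\<bar>"
  shows "\<rho>^2 * frob_sq (matrix_pow W k) \<le> (2 * \<rho>^2 + (W$1$2)^2) * (real k)^2 * (\<rho>^k)^2"
proof -
  have "\<bar>W$1$1\<bar>^k \<le> \<rho>^k" "\<bar>W$2$2\<bar>^k \<le> \<rho>^k" "\<bar>\<rho>\<bar> = \<rho>"
    by (auto simp: \<rho>_def intro: power_mono)
  then have diag: "((W$1$1)^k)^2 \<le> (\<rho>^k)^2" "((W$2$2)^k)^2 \<le> (\<rho>^k)^2"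
    by (simp_all add: abs_le_square_iff[symmetric] power_abs)
  have "(\<rho> * \<bar>(matrix_pow W k)$1$2\<bar>)^2 \<le> (real k * \<bar>W$1$2\<bar> * \<rho>^k)^2"
    using matrix_pow_upper_triangular_bound[OF assms(1), of k]
    by (intro power_mono mult_nonneg_nonneg) (simp_all add: \<rho>_def le_max_iff_disj)
  then have off: "\<rho>^2 * ((matrix_pow W k)$1$2)^2 \<le> (real k)^2 * (W$1$2)^2 * (\<rho>^k)^2"
    by (simp add: power_mult_distrib)
  have "(1::real) \<le> (real k)^2"
    using assms(2) by simp
  then have "\<rho>^2 * 2 * (\<rho>^k)^2 \<le> 2 * \<rho>^2 * (real k)^2 * (\<rho>^k)^2"
    using mult_right_mono[of 1 "(real k)^2" "2 * \<rho>^2 * (\<rho>^k)^2"] by (simp add: mult_ac)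
  then show ?thesis
    using diag off mult_left_mono[OF diag(1), of "\<rho>^2"] mult_left_mono[OF diag(2), of "\<rho>^2"]
    by (simp add: frob_sq_def matrix_pow_upper_triangular assms(1) algebra_simps)
qed

lemma max_sq_lt_of_two_sided_gap:
  fixes a d \<sigma> :: real
  assumes "0 < \<sigma>" and "\<sigma> * \<bar>d\<bar> < \<bar>a\<bar>" and "\<sigma> * \<bar>a\<bar> < \<bar>d\<bar>"
  shows "\<sigma> * (max \<bar>a\<bar> \<bar>d\<bar>)^2 < \<bar>a * d\<bar>"
proof (cases "\<bar>a\<bar> \<le> \<bar>d\<bar>")
  case True
  have "0 \<le> \<sigma> * \<bar>a\<bar>"
    using assms(1) by simp
  then have "\<sigma> * \<bar>d\<bar> * \<bar>d\<bar> < \<bar>a\<bar> * \<bar>d\<bar>"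
    using assms(2,3) by (intro mult_strict_right_mono) auto
  with True show ?thesis
    by (simp add: max_def abs_mult power2_eq_square mult.assoc)
next
  case False
  have "0 \<le> \<sigma> * \<bar>d\<bar>"
    using assms(1) by simp
  then have "\<bar>a\<bar> * (\<sigma> * \<bar>a\<bar>) < \<bar>a\<bar> * \<bar>d\<bar>"
    using assms(2,3) by (intro mult_strict_left_mono) auto
  with False show ?thesis
    by (simp add: max_def abs_mult power2_eq_square mult_ac)
qed

lemma upper_triangular_power_gap:
  fixes W :: "real^2^2"
  assumes tri: "W$2$1 = 0" and \<sigma>: "0 < \<sigma>" and C: "0 \<le> C"
    and dom: "\<forall>k\<ge>1. \<bar>det (matrix_pow W k)\<bar> \<le> C * \<sigma>^k * frob_sq (matrix_pow W k)"
  shows "\<bar>W$1$1\<bar> \<le> \<sigma> * \<bar>W$2$2\<bar> \<or> \<bar>W$2$2\<bar> \<le> \<sigma> * \<bar>W$1$1\<bar>"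
proof (rule ccontr)
  assume "\<not> ?thesis"
  then have gap: "\<sigma> * \<bar>W$2$2\<bar> < \<bar>W$1$1\<bar>" "\<sigma> * \<bar>W$1$1\<bar> < \<bar>W$2$2\<bar>"
    by auto
  define \<rho> where "\<rho> = max \<bar>W$1$1\<bar> \<bar>W$2$2\<bar>"
  have "0 \<le> \<sigma> * \<bar>W$2$2\<bar>"
    using \<sigma> by simp
  then have \<rho>: "0 < \<rho>"
    using gap(1) by (simp add: \<rho>_def less_max_iff_disj)
  define q where "q = \<bar>W$1$1 * W$2$2\<bar> / (\<sigma> * \<rho>^2)"
  have "\<sigma> * \<rho>^2 < \<bar>W$1$1 * W$2$2\<bar>"
    unfolding \<rho>_def by (rule max_sq_lt_of_two_sided_gap[OF \<sigma> gap])
  then have q: "1 < q"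
    using \<rho> \<sigma> by (simp add: q_def)
  define E where "E = C * (2 * \<rho>^2 + (W$1$2)^2)"
  have "eventually (\<lambda>k. E * (real k)^2 < \<rho>^2 * q^k) sequentially"
    using q \<rho> by real_asymp
  then obtain K where "\<forall>k\<ge>K. E * (real k)^2 < \<rho>^2 * q^k"
    unfolding eventually_sequentially by blast
  then obtain k where k: "1 \<le> k" "E * (real k)^2 < \<rho>^2 * q^k"
    using le_add2 le_add1 by blast
  have "q^k * (\<sigma>^k * (\<rho>^k)^2) = \<bar>W$1$1 * W$2$2\<bar>^k"
    using \<rho> \<sigma> by (simp add: q_def power_divide power_mult_distrib mult.commute[of k] flip: power_mult)
  also have "\<dots> = \<bar>det (matrix_pow W k)\<bar>"
    by (simp add: det_upper_triangular_2 matrix_pow_upper_triangular tri power_mult_distrib flip: power_abs)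
  finally have "\<rho>^2 * q^k * (\<sigma>^k * (\<rho>^k)^2) = \<rho>^2 * \<bar>det (matrix_pow W k)\<bar>"
    by (simp add: mult.assoc)
  also have "\<dots> \<le> C * \<sigma>^k * (\<rho>^2 * frob_sq (matrix_pow W k))"
    using mult_left_mono[OF dom[rule_format, OF k(1)], of "\<rho>^2"] by (simp add: mult_ac)
  also have "\<dots> \<le> E * (real k)^2 * (\<sigma>^k * (\<rho>^k)^2)"
    using mult_left_mono[OF frob_sq_matrix_pow_upper_triangular[OF tri k(1)], of "C * \<sigma>^k"] C \<sigma>
    by (simp add: E_def \<rho>_def mult_ac)
  finally have "\<rho>^2 * q^k \<le> E * (real k)^2"
    using \<rho> \<sigma> by simp
  with k(2) show False by simp
qed

lemma exists_word_bounded_sum: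
  fixes s :: "'a \<Rightarrow> real"
  assumes "s i \<le> 0" and "0 \<le> s j"
  shows "\<exists>w. set w \<subseteq> {i, j} \<and> length w = n \<and> \<bar>sum_list (map s w)\<bar> \<le> max (- s i) (s j)"
proof (induction n)
  case 0
  show ?case using assms by (intro exI[of _ "[]"]) auto
next
  case (Suc n)
  then obtain w where w: "set w \<subseteq> {i, j}" "length w = n"
    and bound: "\<bar>sum_list (map s w)\<bar> \<le> max (- s i) (s j)"
    by blast
  show ?case
  proof (cases "0 < sum_list (map s w)")
    case True
    then show ?thesis
      using w bound assms by (intro exI[of _ "i # w"]) (auto simp: abs_le_iff max_def)
  next
    case False
    then show ?thesis
      using w bound assms by (intro exI[of _ "j # w"]) (auto simp: abs_le_iff max_def)
  qed
qed

lemma sign_uniform_of_sum_gap: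
  fixes s :: "nat \<Rightarrow> real"
  assumes c: "0 < c" and gap: "\<forall>w\<in>words N. c * real (length w) \<le> \<bar>sum_list (map s w)\<bar>"
  shows "(\<forall>i<N. 0 < s i) \<or> (\<forall>i<N. s i < 0)"
proof (rule ccontr)
  have "s i \<noteq> 0" if "i < N" for i
    using gap[rule_format, of "[i]"] c that by (auto simp: words_def)
  moreover assume "\<not> ?thesis"
  ultimately obtain i j where ij: "i < N" "j < N" "s i < 0" "0 < s j"
    by (metis linorder_neqE_linordered_idom)
  define M where "M = max (- s i) (s j)"
  obtain n :: nat where n: "M / c < n"
    using reals_Archimedean2 by blast
  obtain w where w: "set w \<subseteq> {i, j}" "length w = n" "\<bar>sum_list (map s w)\<bar> \<le> M"
    using exists_word_bounded_sum[of s i j n] ij unfolding M_def by auto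
  have "w \<in> words N"
    using w(1) ij by (auto simp: words_def)
  then have "c * n \<le> M"
    using gap w by fastforce
  with n c show False
    by (simp add: field_simps)
qed

lemma ln_abs_prod_list:
  fixes f :: "'a \<Rightarrow> real"
  shows "\<forall>i\<in>set w. f i \<noteq> 0 \<Longrightarrow> ln \<bar>prod_list (map f w)\<bar> = sum_list (map (\<lambda>i. ln \<bar>f i\<bar>) w)"
  by (induction w) (auto simp: abs_mult ln_mult prod_list_zero_iff)

lemma diagonal_gap_uniform:
  fixes a d :: "nat \<Rightarrow> real"
  assumes nz: "\<forall>i<N. a i \<noteq> 0 \<and> d i \<noteq> 0" and \<tau>: "0 < \<tau>" "\<tau> < 1"
    and gap: "\<forall>w\<in>words N.
      \<bar>prod_list (map a w)\<bar> \<le> \<tau>^length w * \<bar>prod_list (map d w)\<bar> \<or>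
      \<bar>prod_list (map d w)\<bar> \<le> \<tau>^length w * \<bar>prod_list (map a w)\<bar>"
  shows "(\<forall>i<N. \<bar>d i\<bar> < \<bar>a i\<bar>) \<or> (\<forall>i<N. \<bar>a i\<bar> < \<bar>d i\<bar>)"
proof -
  define s where "s = (\<lambda>i. ln (\<bar>a i\<bar>) - ln (\<bar>d i\<bar>))"
  have "- ln \<tau> * real (length w) \<le> \<bar>sum_list (map s w)\<bar>" if w: "w \<in> words N" for w
  proof -
    define PA where "PA = \<bar>prod_list (map a w)\<bar>"
    define PD where "PD = \<bar>prod_list (map d w)\<bar>"
    have nz_w: "\<forall>i\<in>set w. a i \<noteq> 0" "\<forall>i\<in>set w. d i \<noteq> 0"
      using w nz by (auto simp: words_def)
    then have pos: "0 < PA" "0 < PD"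
      by (auto simp: PA_def PD_def prod_list_zero_iff)
    have sum: "sum_list (map s w) = ln PA - ln PD"
      using nz_w by (simp add: s_def PA_def PD_def ln_abs_prod_list sum_list_subtractf)
    have ln_pow: "ln (\<tau>^length w * P) = ln \<tau> * real (length w) + ln P" if "0 < P" for P
      using \<tau> that by (simp add: ln_mult ln_realpow)
    have "PA \<le> \<tau>^length w * PD \<or> PD \<le> \<tau>^length w * PA"
      using gap w by (simp add: PA_def PD_def)
    then have "ln PA \<le> ln \<tau> * real (length w) + ln PD \<or> ln PD \<le> ln \<tau> * real (length w) + ln PA"
      using pos \<tau> by (auto simp flip: ln_pow)
    then show ?thesis
      unfolding sum by (auto simp: abs_if)
  qed
  then have "(\<forall>i<N. 0 < s i) \<or> (\<forall>i<N. s i < 0)"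
    using \<tau> by (intro sign_uniform_of_sum_gap[of "- ln \<tau>"]) auto
  then show ?thesis
    using nz by (simp add: s_def)
qed

lemma det_dominated_upper_triangular_word_gap:
  assumes dom: "det_dominated N T" and tri: "\<forall>i<N. T i$2$1 = 0"
  obtains \<tau> where "0 < \<tau>" and "\<tau> < 1" and "\<forall>w\<in>words N.
      \<bar>prod_list (map (\<lambda>i. T i$1$1) w)\<bar> \<le> \<tau>^length w * \<bar>prod_list (map (\<lambda>i. T i$2$2) w)\<bar> \<or>
      \<bar>prod_list (map (\<lambda>i. T i$2$2) w)\<bar> \<le> \<tau>^length w * \<bar>prod_list (map (\<lambda>i. T i$1$1) w)\<bar>"
proof -
  obtain C \<tau> where C: "C > 0" and \<tau>: "0 < \<tau>" "\<tau> < 1"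
    and bound: "\<forall>w \<in> words N. \<bar>det (word_prod T w)\<bar> \<le> C * \<tau> ^ length w * frob_sq (word_prod T w)"
    using dom unfolding det_dominated_def by blast
  have "\<forall>w\<in>words N.
      \<bar>prod_list (map (\<lambda>i. T i$1$1) w)\<bar> \<le> \<tau>^length w * \<bar>prod_list (map (\<lambda>i. T i$2$2) w)\<bar> \<or>
      \<bar>prod_list (map (\<lambda>i. T i$2$2) w)\<bar> \<le> \<tau>^length w * \<bar>prod_list (map (\<lambda>i. T i$1$1) w)\<bar>"
  proof
    fix w assume w: "w \<in> words N"
    define W where "W = word_prod T w"
    have W: "W$2$1 = 0" "W$1$1 = prod_list (map (\<lambda>i. T i$1$1) w)"
      "W$2$2 = prod_list (map (\<lambda>i. T i$2$2) w)"
      using w tri unfolding W_def words_def by (auto intro: word_prod_upper_triangular)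
    have "\<bar>W$1$1\<bar> \<le> \<tau>^length w * \<bar>W$2$2\<bar> \<or> \<bar>W$2$2\<bar> \<le> \<tau>^length w * \<bar>W$1$1\<bar>"
    proof (rule upper_triangular_power_gap[OF W(1)])
      show "\<forall>k\<ge>1. \<bar>det (matrix_pow W k)\<bar> \<le> C * (\<tau>^length w)^k * frob_sq (matrix_pow W k)"
      proof (intro allI impI)
        fix k :: nat
        have "length (concat (replicate k w)) = length w * k"
          by (simp add: length_concat sum_list_replicate)
        then show "\<bar>det (matrix_pow W k)\<bar> \<le> C * (\<tau>^length w)^k * frob_sq (matrix_pow W k)"
          using bound[rule_format, OF words_concat_replicate[OF w, of k]]
          by (simp add: W_def word_prod_concat_replicate power_mult)
      qed
    qed (use C \<tau> in auto)
    then show "\<bar>prod_list (map (\<lambda>i. T i$1$1) w)\<bar> \<le> \<tau>^length w * \<bar>prod_list (map (\<lambda>i. T i$2$2) w)\<bar> \<or>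
      \<bar>prod_list (map (\<lambda>i. T i$2$2) w)\<bar> \<le> \<tau>^length w * \<bar>prod_list (map (\<lambda>i. T i$1$1) w)\<bar>"
      unfolding W(2,3) .
  qed
  with \<tau> show thesis
    by (rule that)
qed

lemma det_dominated_upper_triangular_diag_order:
  assumes dom: "det_dominated N T" and T: "\<forall>i<N. invertible (T i) \<and> T i$2$1 = 0"
  shows "(\<forall>i<N. \<bar>T i$2$2\<bar> < \<bar>T i$1$1\<bar>) \<or> (\<forall>i<N. \<bar>T i$1$1\<bar> < \<bar>T i$2$2\<bar>)"
proof -
  have tri: "\<forall>i<N. T i$2$1 = 0"
    using T by blast
  obtain \<tau> where \<tau>: "0 < \<tau>" "\<tau> < 1" and gap: "\<forall>w\<in>words N.
      \<bar>prod_list (map (\<lambda>i. T i$1$1) w)\<bar> \<le> \<tau>^length w * \<bar>prod_list (map (\<lambda>i. T i$2$2) w)\<bar> \<or>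
      \<bar>prod_list (map (\<lambda>i. T i$2$2) w)\<bar> \<le> \<tau>^length w * \<bar>prod_list (map (\<lambda>i. T i$1$1) w)\<bar>"
    by (rule det_dominated_upper_triangular_word_gap[OF dom tri])
  have nz: "\<forall>i<N. T i$1$1 \<noteq> 0 \<and> T i$2$2 \<noteq> 0"
    using T invertible_upper_triangular_2 by blast
  show ?thesis
    by (rule diagonal_gap_uniform[OF nz \<tau> gap])
qed

section \<open>Furstenberg directions\<close>

lemma rank_similar:
  fixes B R :: "real^'n^'n"
  assumes "invertible R"
  shows "rank (matrix_inv R ** B ** R) = rank B"
proof (rule antisym)
  show "rank (matrix_inv R ** B ** R) \<le> rank B"
    using rank_mul_le_left[of "matrix_inv R ** B" R] rank_mul_le_right[of "matrix_inv R" B] by linarith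
  have "rank B = rank (R ** (matrix_inv R ** B ** R) ** matrix_inv R)"
    by (simp add: similar_inverse_cancel assms)
  also have "\<dots> \<le> rank (matrix_inv R ** B ** R)"
    using rank_mul_le_left[of "R ** (matrix_inv R ** B ** R)" "matrix_inv R"]
      rank_mul_le_right[of R "matrix_inv R ** B ** R"] by linarith
  finally show "rank B \<le> rank (matrix_inv R ** B ** R)" .
qed

lemma range_similar:
  fixes B R :: "real^'n^'n"
  assumes "invertible R"
  shows "range ((*v) (matrix_inv R ** B ** R)) = (*v) (matrix_inv R) ` range ((*v) B)"
proof -
  have "surj ((*v) R)"
    by (rule surjI[of _ "(*v) (matrix_inv R)"]) (simp add: matrix_vector_mul_assoc matrix_inv_right assms)
  have "(*v) (matrix_inv R ** B ** R) = (*v) (matrix_inv R) \<circ> (*v) B \<circ> (*v) R"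
    by (simp add: fun_eq_iff matrix_vector_mul_assoc matrix_mul_assoc)
  then have "range ((*v) (matrix_inv R ** B ** R)) = ((*v) (matrix_inv R) \<circ> (*v) B) ` range ((*v) R)"
    by (simp add: image_comp)
  also have "\<dots> = (*v) (matrix_inv R) ` range ((*v) B)"
    using \<open>surj ((*v) R)\<close> by (simp add: image_comp)
  finally show ?thesis .
qed

lemma inj_matrix_vector_mult_invertible:
  fixes R :: "real^'n^'n"
  assumes "invertible R"
  shows "inj ((*v) R)"
proof (rule injI)
  fix x y assume "R *v x = R *v y"
  then have "matrix_inv R *v (R *v x) = matrix_inv R *v (R *v y)"
    by simp
  then show "x = y"
    by (simp add: matrix_vector_mul_assoc matrix_inv_left assms)
qed

lemma furstenberg_dirs_similar:
  assumes R: "invertible R" and A: "\<forall>i<N. invertible (A i)"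
  shows "furstenberg_dirs N (\<lambda>i. matrix_inv R ** A i ** R)
    = (\<lambda>L. (*v) (matrix_inv R) ` L) ` furstenberg_dirs N A"
proof -
  define G :: "real^2^2 \<Rightarrow> real^2^2" where "G B = matrix_inv R ** B ** R" for B
  define S where "S = {c *\<^sub>R word_inv_prod A w | c w. w \<in> words N}"
  have "word_inv_prod (\<lambda>i. matrix_inv R ** A i ** R) w = G (word_inv_prod A w)" if "w \<in> words N" for w
    using that A by (auto simp: G_def words_def intro!: word_inv_prod_similar R)
  moreover have "G (c *\<^sub>R B) = c *\<^sub>R G B" for c B
    by (simp add: G_def matrix_scalar_ac scalar_matrix_assoc[symmetric])
  moreover have set_eq: "{c *\<^sub>R f w | c w. w \<in> words N} = (\<lambda>(c, w). c *\<^sub>R f w) ` (UNIV \<times> words N)"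
    for f :: "nat list \<Rightarrow> real^2^2"
    by auto
  ultimately have S_similar:
    "{c *\<^sub>R word_inv_prod (\<lambda>i. matrix_inv R ** A i ** R) w | c w. w \<in> words N} = G ` S"
    unfolding S_def set_eq image_image by (intro image_cong) auto
  have "inj G"
  proof (rule injI)
    fix B B' assume "G B = G B'"
    then have "R ** G B ** matrix_inv R = R ** G B' ** matrix_inv R"
      by simp
    then show "B = B'"
      by (simp add: G_def similar_inverse_cancel R)
  qed
  moreover have "linear G"
    unfolding G_def by (rule linear_matrix_sandwich)
  ultimately have closure_similar: "closure (G ` S) = G ` closure S"
    by (simp add: closure_injective_linear_image)
  have "furstenberg_dirs N (\<lambda>i. matrix_inv R ** A i ** R)
      = (\<lambda>B. range ((*v) B)) ` {B. rank B = 1 \<and> B \<in> G ` closure S}"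
    unfolding furstenberg_dirs_def S_similar closure_similar by blast
  also have "\<dots> = (\<lambda>B. range ((*v) (G B))) ` {B \<in> closure S. rank B = 1}"
    by (auto simp: G_def rank_similar R)
  also have "\<dots> = (\<lambda>L. (*v) (matrix_inv R) ` L) ` (\<lambda>B. range ((*v) B)) ` {B \<in> closure S. rank B = 1}"
    by (simp add: image_image G_def range_similar R)
  also have "\<dots> = (\<lambda>L. (*v) (matrix_inv R) ` L) ` furstenberg_dirs N A"
    unfolding furstenberg_dirs_def S_def by blast
  finally show ?thesis .
qed

lemma closed_upper_triangular_cone: "closed {B::real^2^2. B$2$1 = 0 \<and> \<bar>B$2$2\<bar> \<le> \<bar>B$1$1\<bar>}"
  by (intro closed_Collect_conj closed_Collect_eq closed_Collect_le continuous_intros)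

lemma range_rank_one_upper_triangular:
  fixes B :: "real^2^2"
  assumes "rank B = 1" and "B$2$1 = 0" and "\<bar>B$2$2\<bar> \<le> \<bar>B$1$1\<bar>"
  shows "range ((*v) B) = {x. x$2 = 0}"
proof -
  have "B \<noteq> 0" and "det B = 0"
    using assms(1) rank_eq_1_2 by auto
  then have B22: "B$2$2 = 0" and B1: "B$1$1 \<noteq> 0 \<or> B$1$2 \<noteq> 0"
    using assms(2,3) by (auto simp: det_upper_triangular_2 mat2_eq_iff)
  show ?thesis
  proof (intro subset_antisym subsetI)
    show "y \<in> {x. x$2 = 0}" if "y \<in> range ((*v) B)" for y
      using that assms(2) B22 by (auto simp: matrix_vector_mult_nth_2)
    show "y \<in> range ((*v) B)" if "y \<in> {x. x$2 = 0}" for y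
    proof
      show "y = B *v (if B$1$1 \<noteq> 0 then vector [y$1 / B$1$1, 0] else vector [0, y$1 / B$1$2])"
        using that B1 assms(2) B22
        by (cases "B$1$1 = 0") (simp_all add: vec2_eq_iff matrix_vector_mult_nth_2)
    qed simp
  qed
qed

lemma upper_triangular_power_limit:
  fixes U :: "real^2^2"
  assumes tri: "U$2$1 = 0" and gap: "\<bar>U$2$2\<bar> < \<bar>U$1$1\<bar>"
  shows "(\<lambda>n. (1 / (U$1$1)^n) *\<^sub>R matrix_pow U n) \<longlonglongrightarrow> mat2x2 1 (U$1$2 / (U$1$1 - U$2$2)) 0 0"
proof -
  define \<alpha> \<beta> \<delta> where "\<alpha> = U$1$1" and "\<beta> = U$1$2" and "\<delta> = U$2$2"
  have \<alpha>: "\<alpha> \<noteq> 0" "\<alpha> - \<delta> \<noteq> 0"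
    using gap unfolding \<alpha>_def \<delta>_def by (metis abs_zero abs_ge_zero not_less, force)
  have ratio: "(\<lambda>n. (\<delta> / \<alpha>)^n) \<longlonglongrightarrow> 0"
    using gap \<alpha> by (intro LIMSEQ_power_zero) (simp add: \<alpha>_def \<delta>_def abs_divide divide_less_eq)
  have off_diag: "(matrix_pow U n)$1$2 / \<alpha>^n = \<beta> * (1 - (\<delta> / \<alpha>)^n) / (\<alpha> - \<delta>)" for n
  proof -
    have "(\<alpha> - \<delta>) * (matrix_pow U n)$1$2 = \<beta> * (\<alpha>^n - \<delta>^n)"
      using matrix_pow_upper_triangular(4)[OF tri] by (simp add: \<alpha>_def \<beta>_def \<delta>_def)
    then have "(matrix_pow U n)$1$2 = \<beta> * (\<alpha>^n - \<delta>^n) / (\<alpha> - \<delta>)"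
      using \<alpha> by (simp add: nonzero_eq_divide_eq mult.commute)
    moreover have "(\<alpha>^n - \<delta>^n) / \<alpha>^n = 1 - (\<delta> / \<alpha>)^n"
      using \<alpha> by (simp add: power_divide diff_divide_distrib)
    ultimately show ?thesis
      by (metis times_divide_eq_right divide_divide_eq_right mult.commute)
  qed
  have entry: "(\<lambda>n. ((1 / \<alpha>^n) *\<^sub>R matrix_pow U n)$i$j) \<longlonglongrightarrow> mat2x2 1 (\<beta> / (\<alpha> - \<delta>)) 0 0 $i$j"
    for i j
  proof -
    have "(\<lambda>n. \<beta> * (1 - (\<delta> / \<alpha>)^n) / (\<alpha> - \<delta>)) \<longlonglongrightarrow> \<beta> * (1 - 0) / (\<alpha> - \<delta>)"
      using \<alpha> by (intro tendsto_intros ratio)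
    then have lim12: "(\<lambda>n. \<beta> * (1 - (\<delta> / \<alpha>)^n) / (\<alpha> - \<delta>)) \<longlonglongrightarrow> \<beta> / (\<alpha> - \<delta>)"
      by simp
    have scaled: "((1 / \<alpha>^n) *\<^sub>R matrix_pow U n)$1$1 = 1"
      "((1 / \<alpha>^n) *\<^sub>R matrix_pow U n)$2$1 = 0"
      "((1 / \<alpha>^n) *\<^sub>R matrix_pow U n)$2$2 = (\<delta> / \<alpha>)^n"
      "((1 / \<alpha>^n) *\<^sub>R matrix_pow U n)$1$2 = \<beta> * (1 - (\<delta> / \<alpha>)^n) / (\<alpha> - \<delta>)" for n
      using \<alpha> off_diag[of n]
      by (simp_all add: matrix_pow_upper_triangular tri \<alpha>_def \<delta>_def power_divide)
    show ?thesis
      using exhaust_2[of i] exhaust_2[of j]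
      by (elim disjE) (simp_all only: scaled mat2x2_nth tendsto_const ratio lim12)
  qed
  have "(\<lambda>n. (1 / \<alpha>^n) *\<^sub>R matrix_pow U n) \<longlonglongrightarrow> mat2x2 1 (\<beta> / (\<alpha> - \<delta>)) 0 0"
    by (intro vec_tendstoI entry)
  then show ?thesis
    unfolding \<alpha>_def \<beta>_def \<delta>_def .
qed

lemma abs_prod_list_mono:
  fixes f g :: "'a \<Rightarrow> real"
  shows "\<forall>i\<in>set w. \<bar>f i\<bar> \<le> \<bar>g i\<bar> \<Longrightarrow> \<bar>prod_list (map f w)\<bar> \<le> \<bar>prod_list (map g w)\<bar>"
  by (induction w) (auto simp: abs_mult intro: mult_mono)

lemma matrix_inv_upper_triangular_diag_lt:
  fixes A :: "real^2^2"
  assumes "invertible A" and "A$2$1 = 0" and "\<bar>A$1$1\<bar> < \<bar>A$2$2\<bar>"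
  shows "matrix_inv A$2$1 = 0" and "\<bar>matrix_inv A$2$2\<bar> < \<bar>matrix_inv A$1$1\<bar>"
proof -
  have "0 < \<bar>A$1$1\<bar>"
    using invertible_upper_triangular_2[OF assms(1,2)] by simp
  then have "1 / \<bar>A$2$2\<bar> < 1 / \<bar>A$1$1\<bar>"
    using assms(3) by (intro divide_strict_left_mono) auto
  then show "matrix_inv A$2$1 = 0" and "\<bar>matrix_inv A$2$2\<bar> < \<bar>matrix_inv A$1$1\<bar>"
    using assms by (simp_all add: matrix_inv_upper_triangular_2 abs_divide)
qed

lemma scaled_word_inv_prod_in_upper_triangular_cone:
  assumes T: "\<forall>i<N. invertible (T i) \<and> T i$2$1 = 0 \<and> \<bar>T i$1$1\<bar> < \<bar>T i$2$2\<bar>"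
    and w: "w \<in> words N"
  shows "c *\<^sub>R word_inv_prod T w \<in> {B. B$2$1 = 0 \<and> \<bar>B$2$2\<bar> \<le> \<bar>B$1$1\<bar>}"
proof -
  have T_inv: "matrix_inv (T i)$2$1 = 0 \<and> \<bar>matrix_inv (T i)$2$2\<bar> < \<bar>matrix_inv (T i)$1$1\<bar>"
    if "i \<in> set w" for i
  proof -
    have "i < N"
      using that w by (auto simp: words_def)
    then show ?thesis
      using T matrix_inv_upper_triangular_diag_lt[of "T i"] by blast
  qed
  define W where "W = word_prod (\<lambda>i. matrix_inv (T i)) w"
  have W: "W$2$1 = 0" "W$1$1 = prod_list (map (\<lambda>i. matrix_inv (T i)$1$1) w)"
    "W$2$2 = prod_list (map (\<lambda>i. matrix_inv (T i)$2$2) w)"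
    using T_inv unfolding W_def by (auto intro!: word_prod_upper_triangular)
  have "\<bar>W$2$2\<bar> \<le> \<bar>W$1$1\<bar>"
    unfolding W(2,3) using T_inv by (intro abs_prod_list_mono) (auto intro: less_imp_le)
  then show ?thesis
    by (simp add: W_def[symmetric] word_inv_prod_eq_word_prod W(1) abs_mult mult_left_mono)
qed

lemma furstenberg_dirs_upper_triangular:
  assumes N: "0 < N"
    and T: "\<forall>i<N. invertible (T i) \<and> T i$2$1 = 0 \<and> \<bar>T i$1$1\<bar> < \<bar>T i$2$2\<bar>"
  shows "furstenberg_dirs N T = {{x. x$2 = 0}}"
proof -
  define S where "S = {c *\<^sub>R word_inv_prod T w | c w. w \<in> words N}"
  have "S \<subseteq> {B. B$2$1 = 0 \<and> \<bar>B$2$2\<bar> \<le> \<bar>B$1$1\<bar>}"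
    unfolding S_def using scaled_word_inv_prod_in_upper_triangular_cone[OF T] by blast
  then have "closure S \<subseteq> {B. B$2$1 = 0 \<and> \<bar>B$2$2\<bar> \<le> \<bar>B$1$1\<bar>}"
    by (rule closure_minimal[OF _ closed_upper_triangular_cone])
  then have dirs: "range ((*v) B) = {x. x$2 = 0}" if "rank B = 1" "B \<in> closure S" for B
    using that range_rank_one_upper_triangular by blast
  define U where "U = matrix_inv (T 0)"
  define B where "B = mat2x2 1 (U$1$2 / (U$1$1 - U$2$2)) 0 (0::real)"
  have "(\<lambda>n. (1 / (U$1$1)^n) *\<^sub>R word_inv_prod T (replicate n 0)) \<longlonglongrightarrow> B"
    using T N matrix_inv_upper_triangular_diag_lt[of "T 0"]
    unfolding B_def U_def word_inv_prod_eq_word_prod word_prod_replicate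
    by (intro upper_triangular_power_limit) auto
  moreover have "(1 / (U$1$1)^n) *\<^sub>R word_inv_prod T (replicate n 0) \<in> S" for n
  proof -
    have "replicate n 0 \<in> words N"
      using N by (auto simp: words_def)
    then show ?thesis
      unfolding S_def by blast
  qed
  ultimately have "B \<in> closure S"
    unfolding closure_sequential
    by (intro exI[of _ "\<lambda>n. (1 / (U$1$1)^n) *\<^sub>R word_inv_prod T (replicate n 0)"]) blast
  moreover have "rank B = 1"
    unfolding rank_eq_1_2 by (simp add: B_def mat2_eq_iff det_2)
  ultimately have "{x. x$2 = 0} \<in> furstenberg_dirs N T"
    unfolding furstenberg_dirs_def S_def[symmetric] using dirs by blast
  moreover have "X = {x. x$2 = 0}" if "X \<in> furstenberg_dirs N T" for X
    using that dirs unfolding furstenberg_dirs_def S_def[symmetric] by blast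
  ultimately show ?thesis
    by blast
qed

lemma inj_image_sets_singleton:
  assumes "inj f" and "(\<lambda>L. f ` L) ` X = {M}"
  shows "\<exists>L. X = {L}"
proof -
  have "X \<noteq> {}"
    using assms(2) by auto
  then obtain L where L: "L \<in> X"
    by blast
  have image_eq: "f ` L' = M" if "L' \<in> X" for L'
    using imageI[OF that, of "\<lambda>L. f ` L"] unfolding assms(2) by simp
  have "L' = L" if "L' \<in> X" for L'
  proof -
    have "f ` L' = f ` L"
      using image_eq[OF that] image_eq[OF L] by simp
    then show ?thesis
      using inj_image_eq_iff[OF assms(1)] by simp
  qed
  with L show ?thesis
    by blast
qed

section \<open>The main theorem\<close>

lemma abs_eigenvalue_le_opnorm:
  assumes "A *v v = c *\<^sub>R v" and "v \<noteq> 0"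
  shows "\<bar>c\<bar> \<le> opnorm A"
proof -
  have "\<bar>c\<bar> * norm v = norm (A *v v)"
    by (simp add: assms(1))
  also have "\<dots> \<le> opnorm A * norm v"
    unfolding opnorm_def by (rule onorm) simp
  finally show ?thesis
    using assms(2) by simp
qed

lemma reducible_imp_similar_upper_triangular:
  fixes A :: "nat \<Rightarrow> real^2^2"
  assumes "reducible N A"
  obtains P :: "real^2^2" where "invertible P"
    and "\<forall>i<N. (matrix_inv P ** A i ** P)$2$1 = 0 \<and> \<bar>(matrix_inv P ** A i ** P)$1$1\<bar> \<le> opnorm (A i)"
proof -
  obtain v :: "real^2" where v: "v \<noteq> 0" and eig: "\<forall>i<N. \<exists>c. A i *v v = c *\<^sub>R v"
    using assms unfolding reducible_def by blast
  define P where "P = mat2x2 (v$1) (- v$2) (v$2) (v$1)"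
  have "det P = (v$1)^2 + (v$2)^2"
    by (simp add: P_def det_2 power2_eq_square)
  also have "\<dots> \<noteq> 0"
    using v by (simp add: vec2_eq_iff sum_power2_eq_zero_iff)
  finally have P: "invertible P"
    by (simp add: invertible_det_nz)
  have Pe: "P *v axis 1 1 = v"
    by (simp add: P_def vec2_eq_iff matrix_vector_mult_nth_2 axis_def)
  have "\<forall>i<N. (matrix_inv P ** A i ** P)$2$1 = 0 \<and> \<bar>(matrix_inv P ** A i ** P)$1$1\<bar> \<le> opnorm (A i)"
  proof (intro allI impI)
    fix i assume "i < N"
    then obtain c where c: "A i *v v = c *\<^sub>R v"
      using eig by blast
    have "(matrix_inv P ** A i ** P) *v axis 1 1 = matrix_inv P *v (A i *v (P *v axis 1 1))"
      by (simp add: matrix_vector_mul_assoc matrix_mul_assoc)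
    also have "\<dots> = c *\<^sub>R (matrix_inv P *v (P *v axis 1 1))"
      by (simp add: Pe c matrix_vector_mult_scaleR)
    also have "\<dots> = c *\<^sub>R axis 1 1"
      using P by (simp add: matrix_vector_mul_assoc matrix_inv_left)
    finally have "(matrix_inv P ** A i ** P)$2$1 = 0 \<and> (matrix_inv P ** A i ** P)$1$1 = c"
      by (simp add: vec2_eq_iff matrix_vector_mult_nth_2 axis_def)
    then show "(matrix_inv P ** A i ** P)$2$1 = 0 \<and> \<bar>(matrix_inv P ** A i ** P)$1$1\<bar> \<le> opnorm (A i)"
      using abs_eigenvalue_le_opnorm[OF c v] by simp
  qed
  with P show thesis
    by (rule that)
qed

lemma similar_upper_triangular_diag_lt:
  fixes A :: "nat \<Rightarrow> real^2^2" and R :: "real^2^2"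
  assumes N: "0 < N" and R: "invertible R" and A: "\<forall>i<N. invertible (A i)"
    and dom: "dominated N A" and tri: "\<forall>i<N. (matrix_inv R ** A i ** R)$2$1 = 0"
    and not_singleton: "\<not> (\<exists>L. furstenberg_dirs N A = {L})"
  shows "\<forall>i<N. \<bar>(matrix_inv R ** A i ** R)$2$2\<bar> < \<bar>(matrix_inv R ** A i ** R)$1$1\<bar>"
proof -
  define T where "T = (\<lambda>i. matrix_inv R ** A i ** R)"
  have T: "\<forall>i<N. invertible (T i) \<and> T i$2$1 = 0"
    using A tri R by (simp add: T_def invertible_similar)
  have "det_dominated N T"
    unfolding T_def by (rule det_dominated_similar[OF R dominated_imp_det_dominated[OF dom]])
  from det_dominated_upper_triangular_diag_order[OF this T]
  consider "\<forall>i<N. \<bar>T i$2$2\<bar> < \<bar>T i$1$1\<bar>" | "\<forall>i<N. \<bar>T i$1$1\<bar> < \<bar>T i$2$2\<bar>"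
    by blast
  then show ?thesis
  proof cases
    case 1
    then show ?thesis by (simp add: T_def)
  next
    case 2
    have "furstenberg_dirs N T = {{x. x$2 = 0}}"
      using 2 T by (intro furstenberg_dirs_upper_triangular[OF N]) simp
    then have "(\<lambda>L. (*v) (matrix_inv R) ` L) ` furstenberg_dirs N A = {{x. x$2 = 0}}"
      using furstenberg_dirs_similar[OF R A] by (simp add: T_def)
    from inj_image_sets_singleton[OF inj_matrix_vector_mult_invertible[OF invertible_matrix_inv[OF R]] this]
    show ?thesis
      using not_singleton by blast
  qed
qed

lemma exists_similar_upper_triangular_diag_lt:
  fixes A :: "nat \<Rightarrow> real^2^2"
  assumes N: "0 < N" and A: "\<forall>i<N. invertible (A i)" and dom: "dominated N A"
    and red: "reducible N A" and contr: "\<forall>i<N. opnorm (A i) < 1"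
    and not_singleton: "\<not> (\<exists>L. furstenberg_dirs N A = {L})"
  shows "\<exists>P::real^2^2. invertible P \<and>
    (\<forall>i<N. (matrix_inv P ** A i ** P)$2$1 = 0 \<and> 0 < \<bar>(matrix_inv P ** A i ** P)$2$2\<bar> \<and>
      \<bar>(matrix_inv P ** A i ** P)$2$2\<bar> < \<bar>(matrix_inv P ** A i ** P)$1$1\<bar> \<and>
      \<bar>(matrix_inv P ** A i ** P)$1$1\<bar> < 1)"
proof -
  obtain P :: "real^2^2" where P: "invertible P" and
    tri: "\<forall>i<N. (matrix_inv P ** A i ** P)$2$1 = 0 \<and> \<bar>(matrix_inv P ** A i ** P)$1$1\<bar> \<le> opnorm (A i)"
    by (rule reducible_imp_similar_upper_triangular[OF red])
  have "0 < \<bar>(matrix_inv P ** A i ** P)$2$2\<bar>" if "i < N" for i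
    using invertible_upper_triangular_2(2)[OF invertible_similar[OF P]] A tri that by simp
  moreover have "\<bar>(matrix_inv P ** A i ** P)$1$1\<bar> < 1" if "i < N" for i
    using tri contr that by (meson order.strict_trans1)
  moreover have "\<forall>i<N. \<bar>(matrix_inv P ** A i ** P)$2$2\<bar> < \<bar>(matrix_inv P ** A i ** P)$1$1\<bar>"
    using similar_upper_triangular_diag_lt[OF N P A dom _ not_singleton] tri by blast
  ultimately show ?thesis
    using P tri by (intro exI[of _ P]) simp
qed

lemma not_simultaneously_diagonalizable:
  fixes A :: "nat \<Rightarrow> real^2^2"
  assumes N: "0 < N" and A: "\<forall>i<N. invertible (A i)" and dom: "dominated N A"
    and not_singleton: "\<not> (\<exists>L. furstenberg_dirs N A = {L})"
  shows "\<not> (\<exists>Q::real^2^2. invertible Q \<and> (\<forall>i<N. diagonal_mat (matrix_inv Q ** A i ** Q)))"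
proof
  assume "\<exists>Q::real^2^2. invertible Q \<and> (\<forall>i<N. diagonal_mat (matrix_inv Q ** A i ** Q))"
  then obtain Q :: "real^2^2" where Q: "invertible Q" and D: "\<forall>i<N. diagonal_mat (matrix_inv Q ** A i ** Q)"
    by blast
  obtain Q' where Q': "invertible Q'" and swap: "\<And>M. matrix_inv Q' ** M ** Q' =
    mat2x2 ((matrix_inv Q ** M ** Q)$2$2) ((matrix_inv Q ** M ** Q)$2$1)
           ((matrix_inv Q ** M ** Q)$1$2) ((matrix_inv Q ** M ** Q)$1$1)"
    using similar_swap_2[OF Q] by blast
  note diag_lt = similar_upper_triangular_diag_lt[OF N _ A dom _ not_singleton]
  have "\<forall>i<N. (matrix_inv Q ** A i ** Q)$2$1 = 0" "\<forall>i<N. (matrix_inv Q' ** A i ** Q')$2$1 = 0"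
    using D by (simp_all add: swap diagonal_mat_def)
  then have "\<bar>(matrix_inv Q ** A 0 ** Q)$2$2\<bar> < \<bar>(matrix_inv Q ** A 0 ** Q)$1$1\<bar>"
    and "\<bar>(matrix_inv Q' ** A 0 ** Q')$2$2\<bar> < \<bar>(matrix_inv Q' ** A 0 ** Q')$1$1\<bar>"
    using diag_lt[OF Q] diag_lt[OF Q'] N by blast+
  then show False
    by (simp add: swap)
qed

theorem mainTheorem11:
  fixes N :: nat and A :: "nat \<Rightarrow> real^2^2"
  assumes "N \<ge> 1"
    and "\<forall>i<N. invertible (A i)"
    and "dominated N A"
    and "reducible N A"
    and "\<forall>i<N. opnorm (A i) < 1"
    and "\<not> (\<exists>L. furstenberg_dirs N A = {L})"
  shows "(\<exists>P::real^2^2. invertible P \<and>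
            (\<forall>i<N. (matrix_inv P ** A i ** P) $ 2 $ 1 = 0 \<and>
                   0 < \<bar>(matrix_inv P ** A i ** P) $ 2 $ 2\<bar> \<and>
                   \<bar>(matrix_inv P ** A i ** P) $ 2 $ 2\<bar> < \<bar>(matrix_inv P ** A i ** P) $ 1 $ 1\<bar> \<and>
                   \<bar>(matrix_inv P ** A i ** P) $ 1 $ 1\<bar> < 1))
       \<and> \<not> (\<exists>Q::real^2^2. invertible Q \<and> (\<forall>i<N. diagonal_mat (matrix_inv Q ** A i ** Q)))"
proof -
  have N: "0 < N"
    using assms(1) by simp
  show ?thesis
    using exists_similar_upper_triangular_diag_lt[OF N assms(2-6)]
      not_simultaneously_diagonalizable[OF N assms(2,3,6)] by (rule conjI)
qed

end
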